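(* Consider the system $x(t+1)=A^*x(t)+B^*u(t)+w(t)$ with $x(t)\in\mathbb{R}^n$, $u(t)\in\mathbb{R}^m$, $w(t)\in\mathcal{Z}_w\subset\mathbb{R}^n$, and put $p=n+m$. Assume: (1) $\theta^*=[A^*\ \ B^*]$ is unknown but belongs to a constrained matrix zonotope $\mathcal{M}_{prior}=\langle G^\theta,C^\theta,A^\theta,B^\theta\rangle$ with $s_\theta$ generators, $C^\theta\in\mathbb{R}^{n\times(n+m)}$, $G^\theta\in\mathbb{R}^{n\times(n+m)s_\theta}$, $A^\theta\in\mathbb{R}^{n_\theta\times m_\theta s_\theta}$, $B^\theta\in\mathbb{R}^{n_\theta\times m_\theta}$; (2) $(A^*,B^* )$ is stabilizable; (3) $\mathcal{Z}_w=\langle G^h,c^h\rangle$ is a zonotope with $G^h\in\mathbb{R}^{n\times s_w}$, $c^h\in\mathbb{R}^n$; (4) the safe set is a polytope $\mathcal{P}=\{x\in\mathbb{R}^n:Hx\le h\}$ with $H\in\mathbb{R}^{q\times n}$, $h\in\mathbb{R}^q$; (5) data $U^0=[u(0)\cdots u(T-1)]$, $X^0=[x(0)\cdots x(T-1)]$, $X^1=[x(1)\cdots x(T)]$ are collected from the system (with some unknown disturbances $w(0),\dots,w(T-1)\in\mathcal{Z}_w$), and $D^0=\begin{bmatrix} X^0 \\ U^0 \end{bmatrix}\in\mathbb{R}^{p\times T}$ has full row rank. Let $M_x$ be a bound on $\|x\|$ for $x\in\mathcal{P}$, let $\langle G^w,C^w\rangle$, $A^C$, $B^C$ be as in the context,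 and put $s_c=s_\theta+Ts_w$. Define $y=[y_1,\dots,y_q]^\top$ and $l=[l_1,\dots,l_q]^\top$ by $$y_j=\sum_{i=1}^{s_w}\big|H_{j,:}\,G^h_{:,i}\big|,$$ $$l_j=M_x\max_{\beta\in\mathbb{R}^{s_c}}\Big\{\Big\|\sum_{i=1}^{Ts_w}\beta_iH_{j,:}G^w_{:,i}\Big\|:\ \sum_{i=1}^{s_c}A^C_{:,i}\beta_i=B^C,\ \|\beta\|\le1\Big\}.$$ Consider the program $$\begin{aligned}\min_{P,V^K,\rho,r}\quad& r\\ \text{s.t.}\quad& Ph\le\lambda h-Hc^h-\rho\,l-y,\\ & PH=H(X^1-C^w)V^K,\\ & \|V^K\|\le\rho,\\ & X^0V^K=I_n,\\ & P\ge0,\end{aligned}$$ with $P\in\mathbb{R}^{q\times q}$, $V^K\in\mathbb{R}^{T\times n}$, $\rho\in\mathbb{R}$ and inequalities understood entrywise, where either $\lambda\in(0,1)$ is fixed and $r=\rho$, or $r=\lambda$ is a decision variable with the additional constraint $0<\lambda<1$. If there exist $V^K,\rho,r,P$ satisfying this program (its constraints), then the controller $u(t)=Kx(t)$ with $K=U^0V^K$ makes $\mathcal{P}$ a robust invariant set of the system: if $x(0)\in\mathcal{P}$, then $x(t)\in\mathcal{P}$ for all $t\ge0$ and all disturbances with $w(t)\in\mathcal{Z}_w$.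
   Context: Norms: $\|\cdot\|$ is the infinity norm of a vector or the (induced) infinity norm of a matrix, i.e. maximal absolute row sum; a row vector $a\in\mathbb{R}^{1\times T}$ is regarded as a $1\times T$ matrix, so $\|a\|=\sum_k|a_k|$. $H_{j,:}$ is the $j$-th row of $H$; $G^h_{:,i}$ is the $i$-th column of $G^h$. Block notation: a generator matrix $G\in\mathbb{R}^{n\times ms}$ is viewed as $G=[G_{:,1},\dots,G_{:,s}]$ with blocks $G_{:,i}\in\mathbb{R}^{n\times m}$; similarly for constraint matrices. For $N\in\mathbb{R}^{m\times k}$, $G\circ N=G(I_s\otimes N)=[G_{:,1}N,\dots,G_{:,s}N]$. Zonotope: $\langle G,c\rangle=\{G\zeta+c:\|\zeta\|\le1\}$. Constrained matrix zonotope of dimension $(n,m)$ with $s$ generators: $\langle G,C,\bar A,\bar B\rangle=\{C+\sum_{i=1}^sG_{:,i}\zeta_i:\ \zeta\in\mathbb{R}^s,\ \|\zeta\|\le1,\ \sum_{i=1}^s\bar A_{:,i}\zeta_i=\bar B\}$, where $G_{:,i},C\in\mathbb{R}^{n\times m}$ and $\bar A_{:,i},\bar B\in\mathbb{R}^{n_c\times m_c}$; without the equality constraint it is a matrix zonotope $\langle G,C\rangle$. Disturbance sequences: $\langle G^w,C^w\rangle$ is the matrix zonotope of all $n\times T$ matrices whose columns lie in $\mathcal{Z}_w$. Here $C^w=[c^h\ \cdots\ c^h]\in\mathbb{R}^{n\times T}$, and $G^w$ has $Ts_w$ blocks $G^w_{:,k}\in\mathbb{R}^{n\times T}$, one for each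 pair $(i,j)$ with $1\le i\le s_w$, $1\le j\le T$, namely the matrix whose $j$-th column is the $i$-th column of $G^h$ and whose other columns are zero. Constraint matrices: $$A^C=\begin{bmatrix}\bar A^w&\mathbf{0}\\ \mathbf{0}&\bar A^\theta\\ \bar G^w&-\bar G^\theta\end{bmatrix},\qquad B^C=\begin{bmatrix}\bar B^w\\ \bar B^\theta\\ \bar C^\theta-\bar C^w\end{bmatrix},$$ where, with $b=\max(T,m_\theta)$, the barred matrices are obtained by appending zero columns on the right of every block so that each block has exactly $b$ columns: $\bar A^w,\bar B^w$ from $A^w=G^w\circ(D^0)^\bot$ ($Ts_w$ blocks of size $n\times(T-p)$) and $B^w=(X^1-C^w)(D^0)^\bot$; $\bar A^\theta,\bar B^\theta$ from $A^\theta$ ($s_\theta$ blocks of size $n_\theta\times m_\theta$) and $B^\theta$; $\bar G^w,\bar C^w$ from $G^w$ and $C^w$; $\bar G^\theta,\bar C^\theta$ from $-G^\theta\circ D^0$ ($s_\theta$ blocks of size $n\times T$) and $X^1-C^\theta D^0$. Here $(D^0)^\bot$ is a matrix whose columns form a basis of the kernel of $D^0$. The zero blocks have sizes $n\times bs_\theta$ and $n_\theta\times bTs_w$. $A^C$ thus has $s_c=s_\theta+Ts_w$ blocks $A^C_{:,i}$, each with $b$ columns.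
   Formalization: The added assumption is that the safe set contains the origin (h ≥ 0); without it the claim fails, e.g. for safe set [2,3], closed loop x(t+1)=x(t)/2, no disturbance, P=I/2, λ=1/2, where the constraints hold but 2 is mapped to 1. *)

theory Defs
  imports
    Complex_Main
    "Jordan_Normal_Form.Matrix_Kernel"
    "Jordan_Normal_Form.DL_Rank"
    "Jordan_Normal_Form.Char_Poly"
begin

(* Infinity norm and induced infinity norm (maximal absolute row sum). The inserted 0 makes Max
   meaningful for objects without entries or rows; otherwise it does not change the value. *)
definition vec_norm :: "real vec \<Rightarrow> real" where
  "vec_norm v = Max (insert 0 ((\<lambda>i. \<bar>v $ i\<bar>) ` {..<dim_vec v}))"

definition mat_norm :: "real mat \<Rightarrow> real" where
  "mat_norm M = Max (insert 0 ((\<lambda>i. \<Sum>j<dim_col M. \<bar>M $$ (i, j)\<bar>) ` {..<dim_row M}))"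

definition append_cols :: "real mat \<Rightarrow> real mat \<Rightarrow> real mat" where
  "append_cols A B = four_block_mat A B (0\<^sub>m 0 (dim_col A)) (0\<^sub>m 0 (dim_col B))"

definition pad_cols :: "nat \<Rightarrow> real mat \<Rightarrow> real mat" where
  "pad_cols b M = append_cols M (0\<^sub>m (dim_row M) (b - dim_col M))"

(* A generator (or constraint) matrix [G_1, ..., G_s] with s blocks of equal size is represented by
   the list of its blocks. *)

definition block_family :: "nat \<Rightarrow> nat \<Rightarrow> nat \<Rightarrow> real mat list \<Rightarrow> bool" where
  "block_family r c s Gs \<longleftrightarrow> length Gs = s \<and> set Gs \<subseteq> carrier_mat r c"

(* The operation G o N, i.e. G (I_s (x) N) = [G_1 N, ..., G_s N]. *)
definition block_times :: "real mat list \<Rightarrow> real mat \<Rightarrow> real mat list" where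
  "block_times Gs N = map (\<lambda>G. G * N) Gs"

(* The r x c matrix zeta_1 G_1 + ... + zeta_s G_s, where s is the number of blocks in the list;
   further entries of zeta are ignored. *)
definition block_comb :: "nat \<Rightarrow> nat \<Rightarrow> real mat list \<Rightarrow> real vec \<Rightarrow> real mat" where
  "block_comb r c Gs \<zeta> = mat r c (\<lambda>ij. \<Sum>k<length Gs. \<zeta> $ k * (Gs ! k) $$ ij)"

definition zonotope :: "real mat \<Rightarrow> real vec \<Rightarrow> real vec set" where
  "zonotope G c = {G *\<^sub>v \<zeta> + c | \<zeta>. \<zeta> \<in> carrier_vec (dim_col G) \<and> vec_norm \<zeta> \<le> 1}"

definition constrained_matrix_zonotope ::
    "real mat list \<Rightarrow> real mat \<Rightarrow> real mat list \<Rightarrow> real mat \<Rightarrow> real mat set" where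
  "constrained_matrix_zonotope Gs C As B =
    {C + block_comb (dim_row C) (dim_col C) Gs \<zeta> | \<zeta>.
      \<zeta> \<in> carrier_vec (length Gs) \<and> vec_norm \<zeta> \<le> 1 \<and>
      block_comb (dim_row B) (dim_col B) As \<zeta> = B}"

definition polytope :: "real mat \<Rightarrow> real vec \<Rightarrow> real vec set" where
  "polytope H h = {x \<in> carrier_vec (dim_col H). H *\<^sub>v x \<le> h}"

(* Discrete-time stabilizability: some state feedback makes A + B K a Schur matrix. *)
definition stabilizable :: "real mat \<Rightarrow> real mat \<Rightarrow> bool" where
  "stabilizable A B \<longleftrightarrow>
    (\<exists>K \<in> carrier_mat (dim_col B) (dim_row A).
      \<forall>\<mu>. eigenvalue (map_mat complex_of_real (A + B * K)) \<mu> \<longrightarrow> cmod \<mu> < 1)"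

definition full_row_rank :: "real mat \<Rightarrow> bool" where
  "full_row_rank D \<longleftrightarrow> vec_space.rank (dim_row D) D = dim_row D"

definition kernel_basis_mat :: "real mat \<Rightarrow> real mat \<Rightarrow> bool" where
  "kernel_basis_mat D N \<longleftrightarrow>
    dim_row N = dim_col D \<and> distinct (cols N) \<and>
    vectorspace.basis class_ring
      ((module_vec TYPE(real) (dim_col D))\<lparr>carrier := mat_kernel D\<rparr>) (set (cols N))"

(* Block number i * T + j has the i-th column of Gh as its j-th column (counting from 0). *)
definition disturbance_gens :: "nat \<Rightarrow> real mat \<Rightarrow> real mat list" where
  "disturbance_gens T Gh =
    [mat (dim_row Gh) T (\<lambda>(a, b). if b = j then Gh $$ (a, i) else 0). i \<leftarrow> [0..<dim_col Gh], j \<leftarrow> [0..<T]]"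

definition disturbance_center :: "nat \<Rightarrow> real vec \<Rightarrow> real mat" where
  "disturbance_center T c = mat_of_cols (dim_vec c) (replicate T c)"

(* The blocks of
       [ Aw    0  ]
       [ 0     At ]
       [ Gw   -Gt ]
   where Aw, At, Gw, Gt are lists of blocks which are padded to width b. *)
definition constraint_gens ::
    "nat \<Rightarrow> nat \<Rightarrow> nat \<Rightarrow> real mat list \<Rightarrow> real mat list \<Rightarrow> real mat list \<Rightarrow> real mat list \<Rightarrow> real mat list" where
  "constraint_gens n n\<^sub>\<theta> b Aw At Gw Gt =
    map2 (\<lambda>A G. pad_cols b A @\<^sub>r 0\<^sub>m n\<^sub>\<theta> b @\<^sub>r pad_cols b G) Aw Gw @
    map2 (\<lambda>A G. 0\<^sub>m n b @\<^sub>r pad_cols b A @\<^sub>r (- pad_cols b G)) At Gt"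

definition constraint_rhs ::
    "nat \<Rightarrow> real mat \<Rightarrow> real mat \<Rightarrow> real mat \<Rightarrow> real mat \<Rightarrow> real mat" where
  "constraint_rhs b Bw Bt Ct Cw = pad_cols b Bw @\<^sub>r pad_cols b Bt @\<^sub>r (pad_cols b Ct - pad_cols b Cw)"

definition y_vec :: "real mat \<Rightarrow> real mat \<Rightarrow> real vec" where
  "y_vec H Gh = vec (dim_row H) (\<lambda>j. \<Sum>i<dim_col Gh. \<bar>row H j \<bullet> col Gh i\<bar>)"

(* The maximum is written as a supremum; it is attained because the set of admissible \<beta> is compact. *)
definition l_vec ::
    "real \<Rightarrow> real mat \<Rightarrow> nat \<Rightarrow> real mat list \<Rightarrow> real mat list \<Rightarrow> real mat \<Rightarrow> real vec" where
  "l_vec Mx H T Gw AC BC = vec (dim_row H) (\<lambda>j. Mx *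
    Sup {mat_norm (block_comb 1 T (map (\<lambda>G. mat_of_row (row H j) * G) Gw) \<beta>) | \<beta>.
      \<beta> \<in> carrier_vec (length AC) \<and> block_comb (dim_row BC) (dim_col BC) AC \<beta> = BC \<and> vec_norm \<beta> \<le> 1})"

definition program_constraints ::
    "real mat \<Rightarrow> real vec \<Rightarrow> real vec \<Rightarrow> real mat \<Rightarrow> real mat \<Rightarrow> real mat \<Rightarrow> real vec \<Rightarrow> real vec \<Rightarrow>
     real \<Rightarrow> real mat \<Rightarrow> real mat \<Rightarrow> real \<Rightarrow> bool" where
  "program_constraints H h ch X0 X1 Cw l y lam P VK \<rho> \<longleftrightarrow>
    P \<in> carrier_mat (dim_row H) (dim_row H) \<and>
    VK \<in> carrier_mat (dim_col X0) (dim_row X0) \<and>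
    P *\<^sub>v h \<le> lam \<cdot>\<^sub>v h - H *\<^sub>v ch - \<rho> \<cdot>\<^sub>v l - y \<and>
    P * H = H * (X1 - Cw) * VK \<and>
    mat_norm VK \<le> \<rho> \<and>
    X0 * VK = 1\<^sub>m (dim_row X0) \<and>
    0\<^sub>m (dim_row H) (dim_row H) \<le> P"

definition system_step ::
    "real mat \<Rightarrow> real mat \<Rightarrow> (nat \<Rightarrow> real vec) \<Rightarrow> (nat \<Rightarrow> real vec) \<Rightarrow> (nat \<Rightarrow> real vec) \<Rightarrow> nat \<Rightarrow> bool" where
  "system_step A B x u w t \<longleftrightarrow> x (Suc t) = A *\<^sub>v x t + B *\<^sub>v u t + w t"

definition robust_invariant ::
    "real mat \<Rightarrow> real mat \<Rightarrow> real mat \<Rightarrow> real vec set \<Rightarrow> real vec set \<Rightarrow> bool" where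
  "robust_invariant A B K W S \<longleftrightarrow>
    (\<forall>x w. x 0 \<in> S \<longrightarrow> (\<forall>t. w t \<in> W) \<longrightarrow> (\<forall>t. system_step A B x (\<lambda>s. K *\<^sub>v x s) w t) \<longrightarrow>
      (\<forall>t. x t \<in> S))"

end

theory Submission
  imports Defs
begin

text \<open>Let \<open>W\<close> be the unknown disturbance matrix of the data and \<open>\<Delta> = W - C\<^sup>w\<close>. As \<open>X\<^sup>0 V\<^sup>K = I\<close>, the closed-loop
  matrix is \<open>(A X\<^sup>0 + B U\<^sup>0) V\<^sup>K = (X\<^sup>1 - C\<^sup>w) V\<^sup>K - \<Delta> V\<^sup>K\<close>. Since \<open>P \<ge> 0\<close>, the first
  part satisfies \<open>H (X\<^sup>1 - C\<^sup>w) V\<^sup>K x = P H x \<le> P h\<close> on the polytope, whereas row \<open>j\<close> of \<open>H \<Delta> V\<^sup>K x\<close>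
  is at most \<open>\<rho> l\<^sub>j\<close> in absolute value: the coefficients of \<open>\<Delta>\<close>, together with those of \<open>[A B]\<close> in
  the prior, are an admissible \<open>\<beta>\<close> in the maximization that defines \<open>l\<^sub>j\<close>. The current disturbance adds at
  most \<open>H c\<^sup>h + y\<close>, so the first constraint leaves \<open>H x(t+1) \<le> \<lambda> h \<le> h\<close>.\<close>

section \<open>Infinity norms of vectors and matrices\<close>

lemma abs_le_vec_norm: "i < dim_vec v \<Longrightarrow> \<bar>v $ i\<bar> \<le> vec_norm v"
  unfolding vec_norm_def by (intro Max_ge) auto

lemma vec_norm_nonneg: "0 \<le> vec_norm v"
  unfolding vec_norm_def by (intro Max_ge) auto

text \<open>The conjunct \<open>0 \<le> c\<close> stems from the 0 inserted into the maximum; it has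
  content only for a vector without entries.\<close>

lemma vec_norm_le_iff: "vec_norm v \<le> c \<longleftrightarrow> 0 \<le> c \<and> (\<forall>i<dim_vec v. \<bar>v $ i\<bar> \<le> c)"
  unfolding vec_norm_def by (subst Max_le_iff) auto

lemma row_sum_le_mat_norm: "i < dim_row M \<Longrightarrow> (\<Sum>j<dim_col M. \<bar>M $$ (i, j)\<bar>) \<le> mat_norm M"
  unfolding mat_norm_def by (intro Max_ge) auto

lemma mat_norm_nonneg: "0 \<le> mat_norm M"
  unfolding mat_norm_def by (intro Max_ge) auto

lemma mat_norm_le_iff:
  "mat_norm M \<le> c \<longleftrightarrow> 0 \<le> c \<and> (\<forall>i<dim_row M. (\<Sum>j<dim_col M. \<bar>M $$ (i, j)\<bar>) \<le> c)"
  unfolding mat_norm_def by (subst Max_le_iff) auto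

text \<open>Hoelder's inequality for the 1-norm and the infinity norm. With a matrix row as
  \<open>a\<close>, the first factor is an absolute row sum.\<close>

lemma abs_scalar_prod_le:
  assumes "dim_vec v = dim_vec a"
  shows "\<bar>a \<bullet> v\<bar> \<le> (\<Sum>k<dim_vec a. \<bar>a $ k\<bar>) * vec_norm v"
proof -
  have "\<bar>a \<bullet> v\<bar> \<le> (\<Sum>k<dim_vec a. \<bar>a $ k\<bar> * \<bar>v $ k\<bar>)"
    unfolding scalar_prod_def assms atLeast0LessThan
    by (rule order_trans[OF sum_abs]) (simp add: abs_mult)
  also have "\<dots> \<le> (\<Sum>k<dim_vec a. \<bar>a $ k\<bar> * vec_norm v)"
    using assms by (intro sum_mono mult_left_mono abs_le_vec_norm) auto
  finally show ?thesis by (simp add: sum_distrib_right)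
qed

lemma vec_norm_mult_le:
  assumes "dim_vec v = dim_col M"
  shows "vec_norm (M *\<^sub>v v) \<le> mat_norm M * vec_norm v"
  unfolding vec_norm_le_iff
proof (intro conjI allI impI)
  show "0 \<le> mat_norm M * vec_norm v"
    by (simp add: mat_norm_nonneg vec_norm_nonneg)
  fix i assume i: "i < dim_vec (M *\<^sub>v v)"
  have "\<bar>row M i \<bullet> v\<bar> \<le> (\<Sum>k<dim_col M. \<bar>M $$ (i, k)\<bar>) * vec_norm v"
    using abs_scalar_prod_le[of v "row M i"] assms i by simp
  also have "\<dots> \<le> mat_norm M * vec_norm v"
    using i by (intro mult_right_mono row_sum_le_mat_norm vec_norm_nonneg) auto
  finally show "\<bar>(M *\<^sub>v v) $ i\<bar> \<le> mat_norm M * vec_norm v" using i by simp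
qed

section \<open>Linear combinations of blocks\<close>

lemma block_comb_carrier [simp]: "block_comb r c Gs \<zeta> \<in> carrier_mat r c"
  and dim_row_block_comb [simp]: "dim_row (block_comb r c Gs \<zeta>) = r"
  and dim_col_block_comb [simp]: "dim_col (block_comb r c Gs \<zeta>) = c"
  by (simp_all add: block_comb_def)

lemma block_comb_index [simp]:
  "i < r \<Longrightarrow> j < c \<Longrightarrow> block_comb r c Gs \<zeta> $$ (i, j) = (\<Sum>k<length Gs. \<zeta> $ k * (Gs ! k) $$ (i, j))"
  by (simp add: block_comb_def)

text \<open>Two finite sums are interchanged. A row of \<open>H\<close>, which \<open>l_vec\<close>
  multiplies into every block, can thus act on the combined disturbance matrix.\<close>

lemma block_comb_mult_left:
  assumes L: "L \<in> carrier_mat r n" and Gs: "set Gs \<subseteq> carrier_mat n c"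
  shows "block_comb r c (map (\<lambda>G. L * G) Gs) \<zeta> = L * block_comb n c Gs \<zeta>"
proof (rule eq_matI)
  fix i j assume "i < dim_row (L * block_comb n c Gs \<zeta>)" "j < dim_col (L * block_comb n c Gs \<zeta>)"
  then have ij: "i < r" "j < c" using L by auto
  have G: "dim_row (Gs ! k) = n" "dim_col (Gs ! k) = c" if "k < length Gs" for k
    using Gs nth_mem[OF that] by auto
  have "(L * block_comb n c Gs \<zeta>) $$ (i, j)
      = (\<Sum>x<n. \<Sum>k<length Gs. \<zeta> $ k * (L $$ (i, x) * (Gs ! k) $$ (x, j)))"
    using L ij by (simp add: scalar_prod_def atLeast0LessThan sum_distrib_left mult.left_commute)
  also have "\<dots> = (\<Sum>k<length Gs. \<zeta> $ k * (L * Gs ! k) $$ (i, j))"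
    using L ij G
    by (subst sum.swap) (auto simp: scalar_prod_def atLeast0LessThan sum_distrib_left intro!: sum.cong)
  finally show "block_comb r c (map (\<lambda>G. L * G) Gs) \<zeta> $$ (i, j) = (L * block_comb n c Gs \<zeta>) $$ (i, j)"
    using ij by simp
qed (use L in auto)

text \<open>The same exchange on the right. It serves for \<open>Dperp\<close> in the first row band
  of the constraints and for \<open>D0\<close> in the third.\<close>

lemma block_comb_block_times:
  assumes N: "N \<in> carrier_mat n c" and Gs: "set Gs \<subseteq> carrier_mat r n"
  shows "block_comb r c (block_times Gs N) \<zeta> = block_comb r n Gs \<zeta> * N"
proof (rule eq_matI)
  fix i j assume "i < dim_row (block_comb r n Gs \<zeta> * N)" "j < dim_col (block_comb r n Gs \<zeta> * N)"
  then have ij: "i < r" "j < c" using N by auto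
  have G: "dim_row (Gs ! k) = r" "dim_col (Gs ! k) = n" if "k < length Gs" for k
    using Gs nth_mem[OF that] by auto
  have "(block_comb r n Gs \<zeta> * N) $$ (i, j)
      = (\<Sum>x<n. \<Sum>k<length Gs. \<zeta> $ k * ((Gs ! k) $$ (i, x) * N $$ (x, j)))"
    using N ij by (simp add: scalar_prod_def atLeast0LessThan sum_distrib_right mult.assoc)
  also have "\<dots> = (\<Sum>k<length Gs. \<zeta> $ k * (Gs ! k * N) $$ (i, j))"
    using N ij G
    by (subst sum.swap) (auto simp: scalar_prod_def atLeast0LessThan sum_distrib_left intro!: sum.cong)
  finally show "block_comb r c (block_times Gs N) \<zeta> $$ (i, j) = (block_comb r n Gs \<zeta> * N) $$ (i, j)"
    using ij by (simp add: block_times_def)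
qed (use N in auto)

lemma block_comb_uminus:
  assumes "set Gs \<subseteq> carrier_mat r c"
  shows "block_comb r c (map uminus Gs) \<zeta> = - block_comb r c Gs \<zeta>"
proof (rule eq_matI)
  fix i j assume "i < dim_row (- block_comb r c Gs \<zeta>)" "j < dim_col (- block_comb r c Gs \<zeta>)"
  moreover have "dim_row (Gs ! k) = r" "dim_col (Gs ! k) = c" if "k < length Gs" for k
    using assms nth_mem[OF that] by auto
  ultimately show "block_comb r c (map uminus Gs) \<zeta> $$ (i, j) = (- block_comb r c Gs \<zeta>) $$ (i, j)"
    by (auto simp: sum_negf[symmetric] intro!: sum.cong)
qed auto

section \<open>Padding and stacking\<close>

lemma pad_cols_carrier [simp, intro]:
  "M \<in> carrier_mat r c \<Longrightarrow> c \<le> b \<Longrightarrow> pad_cols b M \<in> carrier_mat r b"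
  by (auto simp: pad_cols_def append_cols_def)

lemma pad_cols_index:
  assumes "M \<in> carrier_mat r c" "c \<le> b" "i < r" "j < b"
  shows "pad_cols b M $$ (i, j) = (if j < c then M $$ (i, j) else 0)"
  using assms by (auto simp: pad_cols_def append_cols_def)

lemma append_rows_index:
  assumes "X \<in> carrier_mat r c" "Y \<in> carrier_mat r' c" "i < r + r'" "j < c"
  shows "(X @\<^sub>r Y) $$ (i, j) = (if i < r then X $$ (i, j) else Y $$ (i - r, j))"
  using assms by (auto simp: append_rows_def)

section \<open>Generators of the disturbance sequences\<close>

lemma length_disturbance_gens [simp]: "length (disturbance_gens T G) = dim_col G * T"
  by (simp add: disturbance_gens_def length_concat sum_list_triv comp_def)

text \<open>The nested enumeration is flattened: position \<open>k = i * T + j\<close> is decoded by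
  \<open>div\<close> and \<open>mod\<close>. For \<open>T = 0\<close> both lists are empty.\<close>

lemma concat_map_upt_div_mod:
  "concat (map (\<lambda>i. map (f i) [0..<T]) [0..<s]) = map (\<lambda>k. f (k div T) (k mod T)) [0..<s * T]"
proof (induction s)
  case (Suc s)
  have "[0..<Suc s * T] = [0..<s * T] @ map (\<lambda>j. s * T + j) [0..<T]"
    using upt_add_eq_append[of 0 "s * T" T] map_add_upt[of "s * T" T] by (simp add: add.commute)
  then show ?case using Suc by (simp add: comp_def)
qed simp

lemma disturbance_gens_eq_map:
  "disturbance_gens T G
   = map (\<lambda>k. mat (dim_row G) T (\<lambda>(a, c). if c = k mod T then G $$ (a, k div T) else 0))
       [0..<dim_col G * T]"
  unfolding disturbance_gens_def by (rule concat_map_upt_div_mod)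

text \<open>Only the blocks numbered \<open>i * T + j\<close> reach column \<open>j\<close>, so this
  column is \<open>G\<close> applied to the coefficients at these positions.\<close>

lemma block_comb_disturbance_gens:
  assumes "a < dim_row G" "j < T"
  shows "block_comb (dim_row G) T (disturbance_gens T G) \<beta> $$ (a, j)
    = (\<Sum>i<dim_col G. G $$ (a, i) * \<beta> $ (i * T + j))"
proof -
  let ?f = "\<lambda>k. \<beta> $ k * (if j = k mod T then G $$ (a, k div T) else 0)"
  have "block_comb (dim_row G) T (disturbance_gens T G) \<beta> $$ (a, j) = sum ?f {..<dim_col G * T}"
    using assms by (auto simp: disturbance_gens_eq_map intro!: sum.cong)
  \<comment> \<open>The index range is cut into segments of length \<open>T\<close>, one for each
    column of \<open>G\<close>; only the \<open>j\<close>-th term of a segment can be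
    nonzero.\<close>
  also have "\<dots> = (\<Sum>i<dim_col G. sum ?f {i * T..<i * T + T})"
    by (simp only: sum.nat_group)
  also have "\<dots> = (\<Sum>i<dim_col G. G $$ (a, i) * \<beta> $ (i * T + j))"
  proof (rule sum.cong)
    fix i
    have "sum ?f {i * T..<i * T + T} = (\<Sum>c<T. ?f (i * T + c))"
      by (simp add: sum.atLeastLessThan_shift_0 atLeast0LessThan)
    also have "\<dots> = (\<Sum>c<T. if c = j then G $$ (a, i) * \<beta> $ (i * T + j) else 0)"
      by (intro sum.cong) auto
    also have "\<dots> = G $$ (a, i) * \<beta> $ (i * T + j)" using assms by simp
    finally show "sum ?f {i * T..<i * T + T} = G $$ (a, i) * \<beta> $ (i * T + j)" .
  qed simp
  finally show ?thesis .
qed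

section \<open>Matrices whose columns form a kernel basis\<close>

lemma kernel_basis_mat_carrier:
  assumes "kernel_basis_mat D N"
  shows "N \<in> carrier_mat (dim_col D) (dim_col N)"
  using assms by (auto simp: kernel_basis_mat_def)

text \<open>Columns that are independent in the kernel are independent in the ambient space
  (\<open>lindep_same\<close>), which bounds the cardinality of their set; distinctness turns this
  into a bound on the number of columns.\<close>

lemma
  assumes "kernel_basis_mat D N"
  shows dim_col_kernel_basis_mat_le: "dim_col N \<le> dim_col D"
    and mult_kernel_basis_mat: "D * N = 0\<^sub>m (dim_row D) (dim_col N)"
proof -
  interpret kernel "dim_row D" "dim_col D" D by unfold_locales simp
  have dist: "distinct (cols N)" and basis: "basis (set (cols N))" and dimN: "dim_row N = dim_col D"
    using assms by (auto simp: kernel_basis_mat_def)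
  have sub: "set (cols N) \<subseteq> mat_kernel D" and "Ker.lin_indpt (set (cols N))"
    using basis unfolding Ker.basis_def by auto
  then have "NC.lin_indpt (set (cols N))" using lindep_same by blast
  moreover have "set (cols N) \<subseteq> carrier_vec (dim_col D)"
    using sub mat_kernel_carrier[of D] by auto
  ultimately have "card (set (cols N)) \<le> dim_col D"
    using NC.li_le_dim(2)[OF NC.fin_dim] NC.dim_is_n by auto
  then show "dim_col N \<le> dim_col D" using distinct_card[OF dist] by simp
  show "D * N = 0\<^sub>m (dim_row D) (dim_col N)"
  proof (rule eq_matI)
    fix i j assume *: "i < dim_row (0\<^sub>m (dim_row D) (dim_col N) :: real mat)" "j < dim_col (0\<^sub>m (dim_row D) (dim_col N) :: real mat)"
    then have "col N j \<in> mat_kernel D" using sub by (auto simp: cols_def)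
    then have "D *\<^sub>v col N j = 0\<^sub>v (dim_row D)" by (simp add: mat_kernel_def)
    then have "(D *\<^sub>v col N j) $ i = 0" using * by simp
    then show "(D * N) $$ (i, j) = 0\<^sub>m (dim_row D) (dim_col N) $$ (i, j)" using * by simp
  qed auto
qed

section \<open>The assembled constraint system\<close>

lemma block_family_nth: "block_family r c s Gs \<Longrightarrow> k < s \<Longrightarrow> Gs ! k \<in> carrier_mat r c"
  unfolding block_family_def using nth_mem by blast

lemma sum_lessThan_add: "sum f {..<a + c} = sum f {..<a} + (\<Sum>k<c. f (a + k))" for a c :: nat
  by (induction c) (auto simp: add.assoc)

text \<open>Each of the three row bands is compared entrywise. The arguments of
  \<open>constraint_rhs\<close> meant for the centers hold combinations of \<open>Gw\<close> and
  \<open>Gt\<close> here: only their difference enters the last band, and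
  \<open>constraint_rhs_cong\<close> can trade it for the difference of the centers.\<close>

lemma block_comb_constraint_gens:
  assumes Aw: "block_family n k s Aw" and At: "block_family n\<^sub>\<theta> c\<^sub>\<theta> s' At"
    and Gw: "block_family n T s Gw" and Gt: "block_family n T s' Gt"
    and le: "k \<le> b" "c\<^sub>\<theta> \<le> b" "T \<le> b"
    and \<beta>: "\<beta> \<in> carrier_vec s" and \<zeta>: "\<zeta> \<in> carrier_vec s'"
  shows "block_comb (n + (n\<^sub>\<theta> + n)) b (constraint_gens n n\<^sub>\<theta> b Aw At Gw Gt) (\<beta> @\<^sub>v \<zeta>)
    = constraint_rhs b (block_comb n k Aw \<beta>) (block_comb n\<^sub>\<theta> c\<^sub>\<theta> At \<zeta>)
        (block_comb n T Gw \<beta>) (block_comb n T Gt \<zeta>)" (is "?L = ?R")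
proof (rule eq_matI)
  have R: "?R \<in> carrier_mat (n + (n\<^sub>\<theta> + n)) b"
    unfolding constraint_rhs_def using le
    by (auto intro!: carrier_append_rows minus_carrier_mat pad_cols_carrier[OF block_comb_carrier])
  then show "dim_row ?L = dim_row ?R" "dim_col ?L = dim_col ?R" by auto
  fix i j assume "i < dim_row ?R" "j < dim_col ?R"
  then have i: "i < n + (n\<^sub>\<theta> + n)" and j: "j < b" using R by auto
  have len: "length Aw = s" "length Gw = s" "length At = s'" "length Gt = s'"
    using assms by (auto simp: block_family_def)
  let ?X = "\<lambda>k. pad_cols b (Aw ! k) @\<^sub>r 0\<^sub>m n\<^sub>\<theta> b @\<^sub>r pad_cols b (Gw ! k)"
  let ?Y = "\<lambda>k. 0\<^sub>m n b @\<^sub>r pad_cols b (At ! k) @\<^sub>r (- pad_cols b (Gt ! k))"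
  have "?L $$ (i, j) = (\<Sum>k<s + s'. (\<beta> @\<^sub>v \<zeta>) $ k * (constraint_gens n n\<^sub>\<theta> b Aw At Gw Gt ! k) $$ (i, j))"
    using i j len by (simp add: constraint_gens_def)
  also have "\<dots> = (\<Sum>k<s. \<beta> $ k * ?X k $$ (i, j)) + (\<Sum>k<s'. \<zeta> $ k * ?Y k $$ (i, j))"
    using \<beta> \<zeta> len
    by (simp add: sum_lessThan_add constraint_gens_def nth_append)
  finally have L: "?L $$ (i, j) = \<dots>" .
  have X: "?X k' $$ (i, j) = (if i < n then pad_cols b (Aw ! k') $$ (i, j)
      else if i < n + n\<^sub>\<theta> then 0 else pad_cols b (Gw ! k') $$ (i - n - n\<^sub>\<theta>, j))" if "k' < s" for k'
  proof -
    have c: "pad_cols b (Aw ! k') \<in> carrier_mat n b" "pad_cols b (Gw ! k') \<in> carrier_mat n b"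
      using block_family_nth[OF Aw that] block_family_nth[OF Gw that] le by auto
    show ?thesis
      using i j by (subst append_rows_index[OF c(1) carrier_append_rows[OF zero_carrier_mat c(2)]])
        (auto simp: append_rows_index[OF zero_carrier_mat c(2)])
  qed
  have Y: "?Y k' $$ (i, j) = (if i < n then 0
      else if i < n + n\<^sub>\<theta> then pad_cols b (At ! k') $$ (i - n, j)
      else - pad_cols b (Gt ! k') $$ (i - n - n\<^sub>\<theta>, j))" if "k' < s'" for k'
  proof -
    have c: "pad_cols b (At ! k') \<in> carrier_mat n\<^sub>\<theta> b" "pad_cols b (Gt ! k') \<in> carrier_mat n b"
      using block_family_nth[OF At that] block_family_nth[OF Gt that] le by auto
    show ?thesis
      using i j c by (subst append_rows_index[OF zero_carrier_mat
          carrier_append_rows[OF c(1) uminus_carrier_mat[OF c(2)]]])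
        (auto simp: append_rows_index[OF c(1) uminus_carrier_mat[OF c(2)]])
  qed
  \<comment> \<open>Padding commutes with linear combination, since the added columns are zero in
    every block.\<close>
  have pad: "pad_cols b (block_comb r c Gs v) $$ (i', j)
      = (\<Sum>k<s. v $ k * pad_cols b (Gs ! k) $$ (i', j))"
    if "block_family r c s Gs" "c \<le> b" "i' < r" for r c s Gs v i'
    using that j block_family_nth[OF that(1)] unfolding block_family_def
    by (auto simp: pad_cols_index[OF block_comb_carrier] pad_cols_index[where r = r and c = c])
  have c: "pad_cols b (block_comb n k Aw \<beta>) \<in> carrier_mat n b"
    "pad_cols b (block_comb n\<^sub>\<theta> c\<^sub>\<theta> At \<zeta>) \<in> carrier_mat n\<^sub>\<theta> b"
    "pad_cols b (block_comb n T Gw \<beta>) \<in> carrier_mat n b"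
    "pad_cols b (block_comb n T Gt \<zeta>) \<in> carrier_mat n b"
    using le by (auto intro!: pad_cols_carrier)
  have "?R $$ (i, j) = (if i < n then pad_cols b (block_comb n k Aw \<beta>) $$ (i, j)
      else if i < n + n\<^sub>\<theta> then pad_cols b (block_comb n\<^sub>\<theta> c\<^sub>\<theta> At \<zeta>) $$ (i - n, j)
      else pad_cols b (block_comb n T Gw \<beta>) $$ (i - n - n\<^sub>\<theta>, j)
         - pad_cols b (block_comb n T Gt \<zeta>) $$ (i - n - n\<^sub>\<theta>, j))"
    unfolding constraint_rhs_def using i j c
    by (subst append_rows_index[OF c(1) carrier_append_rows[OF c(2) minus_carrier_mat[OF c(4)]]])
      (auto simp: append_rows_index[OF c(2) minus_carrier_mat[OF c(4)]])
  then show "?L $$ (i, j) = ?R $$ (i, j)"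
    unfolding L using i X Y pad[OF Aw le(1)] pad[OF At le(2)] pad[OF Gw le(3)] pad[OF Gt le(3)]
    by (auto simp: sum_negf)
qed

text \<open>Padding respects subtraction, so the last band depends on the two centers only through
  their difference.\<close>

lemma constraint_rhs_cong:
  assumes "Ct \<in> carrier_mat r c" "Cw \<in> carrier_mat r c" "Ct' \<in> carrier_mat r c" "Cw' \<in> carrier_mat r c"
    and "c \<le> b" and eq: "Ct - Cw = Ct' - Cw'"
  shows "constraint_rhs b Bw Bt Ct Cw = constraint_rhs b Bw Bt Ct' Cw'"
proof -
  have pad: "pad_cols b X - pad_cols b Y = pad_cols b (X - Y)"
    if "X \<in> carrier_mat r c" "Y \<in> carrier_mat r c" for X Y
    using that \<open>c \<le> b\<close> carrier_matD[OF pad_cols_carrier[OF that(1) \<open>c \<le> b\<close>]]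
      carrier_matD[OF pad_cols_carrier[OF that(2) \<open>c \<le> b\<close>]]
      carrier_matD[OF pad_cols_carrier[OF minus_carrier_mat[OF that(2)] \<open>c \<le> b\<close>, of X]]
    by (intro eq_matI)  (simp_all add: pad_cols_index[where r = r and c = c] pad_cols_index[OF minus_carrier_mat[OF that(2)]])
  show ?thesis unfolding constraint_rhs_def using assms by (simp add: pad)
qed

section \<open>Data equation and disturbance coefficients\<close>

lemma append_cols_mult_append_rows:
  assumes "A \<in> carrier_mat r n" "B \<in> carrier_mat r m" "X \<in> carrier_mat n c" "U \<in> carrier_mat m c"
  shows "append_cols A B * (X @\<^sub>r U) = A * X + B * U"
proof -
  \<comment> \<open>Both concatenations are 2 x 2 block matrices whose remaining blocks have no rows
    or no columns, so only the upper left block of the product has entries.\<close>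
  have "append_cols A B * (X @\<^sub>r U) = four_block_mat (A * X + B * U) (A * 0\<^sub>m n 0 + B * 0\<^sub>m m 0)
      (0\<^sub>m 0 n * X + 0\<^sub>m 0 m * U) (0\<^sub>m 0 n * 0\<^sub>m n 0 + 0\<^sub>m 0 m * 0\<^sub>m m 0)"
    unfolding append_cols_def append_rows_def carrier_matD[OF assms(1)] carrier_matD[OF assms(2)]
      carrier_matD[OF assms(3)] carrier_matD[OF assms(4)]
    by (rule mult_four_block_mat) (use assms in auto)
  also have "\<dots> = A * X + B * U"
    using assms by (intro eq_matI) auto
  finally show ?thesis .
qed

text \<open>Each block of \<open>disturbance_gens\<close> touches one column only, so the
  coefficients of the individual disturbances can be chosen independently.\<close>

lemma disturbance_sequence_in_matrix_zonotope:
  assumes Gh: "Gh \<in> carrier_mat n s" and c: "c \<in> carrier_vec n"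
    and w: "\<And>t. t < T \<Longrightarrow> w t \<in> zonotope Gh c"
  obtains \<beta> where "\<beta> \<in> carrier_vec (s * T)" "vec_norm \<beta> \<le> 1"
    "mat_of_cols n (map w [0..<T]) = disturbance_center T c + block_comb n T (disturbance_gens T Gh) \<beta>"
proof -
  have "\<forall>t. \<exists>z. t < T \<longrightarrow> w t = Gh *\<^sub>v z + c \<and> z \<in> carrier_vec s \<and> vec_norm z \<le> 1"
    using w Gh unfolding zonotope_def by fastforce
  then obtain z where z: "\<And>t. t < T \<Longrightarrow> w t = Gh *\<^sub>v z t + c"
    "\<And>t. t < T \<Longrightarrow> z t \<in> carrier_vec s" "\<And>t. t < T \<Longrightarrow> vec_norm (z t) \<le> 1"
    by metis
  \<comment> \<open>The coefficient vectors are interleaved: entry \<open>i * T + j\<close> is the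
    \<open>i\<close>-th coefficient of \<open>w j\<close>, as the block numbering demands.\<close>
  define \<beta> where "\<beta> = vec (s * T) (\<lambda>k. z (k mod T) $ (k div T))"
  have "vec_norm \<beta> \<le> 1"
    unfolding vec_norm_le_iff
  proof (intro conjI allI impI)
    fix k assume "k < dim_vec \<beta>"
    then have k: "k < s * T" by (simp add: \<beta>_def)
    then have "T > 0" by (cases T) auto
    then have "k mod T < T" "k div T < s" using k by (auto simp: less_mult_imp_div_less)
    then have "\<bar>z (k mod T) $ (k div T)\<bar> \<le> 1"
      using abs_le_vec_norm[of "k div T" "z (k mod T)"] z(2,3)[of "k mod T"] by auto
    then show "\<bar>\<beta> $ k\<bar> \<le> 1" using k by (simp add: \<beta>_def)
  qed simp
  moreover have "mat_of_cols n (map w [0..<T])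
      = disturbance_center T c + block_comb n T (disturbance_gens T Gh) \<beta>"
  proof (rule eq_matI)
    fix a j
    assume "a < dim_row (disturbance_center T c + block_comb n T (disturbance_gens T Gh) \<beta>)"
      "j < dim_col (disturbance_center T c + block_comb n T (disturbance_gens T Gh) \<beta>)"
    then have aj: "a < n" "j < T" by auto
    have "\<beta> $ (i * T + j) = z j $ i" if "i < s" for i
    proof -
      have "i * T + j < Suc i * T" using aj by simp
      also have "\<dots> \<le> s * T" using that by (intro mult_le_mono1) simp
      finally show ?thesis using aj by (simp add: \<beta>_def)
    qed
    then have "block_comb n T (disturbance_gens T Gh) \<beta> $$ (a, j) = (\<Sum>i<s. Gh $$ (a, i) * z j $ i)"
      using block_comb_disturbance_gens[of a Gh j T \<beta>] aj Gh by simp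
    moreover have "w j $ a = (\<Sum>i<s. Gh $$ (a, i) * z j $ i) + c $ a"
      using z(1,2)[OF aj(2)] aj Gh c by (simp add: scalar_prod_def atLeast0LessThan)
    ultimately show "mat_of_cols n (map w [0..<T]) $$ (a, j)
        = (disturbance_center T c + block_comb n T (disturbance_gens T Gh) \<beta>) $$ (a, j)"
      using aj c by (simp add: disturbance_center_def mat_of_cols_index)
  qed (use c in \<open>auto simp: disturbance_center_def\<close>)
  moreover have "\<beta> \<in> carrier_vec (s * T)" by (simp add: \<beta>_def)
  ultimately show ?thesis using that by blast
qed

section \<open>The bounds \<open>l\<close> and \<open>y\<close>\<close>

lemma mat_norm_block_comb_le:
  assumes "\<beta> \<in> carrier_vec s" "length Gs \<le> s" "vec_norm \<beta> \<le> 1"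
  shows "mat_norm (block_comb r c Gs \<beta>) \<le> (\<Sum>i<r. \<Sum>j<c. \<Sum>k<length Gs. \<bar>(Gs ! k) $$ (i, j)\<bar>)"
  unfolding mat_norm_le_iff
proof (intro conjI allI impI)
  show "0 \<le> (\<Sum>i<r. \<Sum>j<c. \<Sum>k<length Gs. \<bar>(Gs ! k) $$ (i, j)\<bar>)" by (intro sum_nonneg) auto
  fix i assume i: "i < dim_row (block_comb r c Gs \<beta>)"
  have "\<bar>\<beta> $ k\<bar> \<le> 1" if "k < length Gs" for k
    using abs_le_vec_norm[of k \<beta>] assms that by auto
  then have "(\<Sum>j<c. \<bar>block_comb r c Gs \<beta> $$ (i, j)\<bar>) \<le> (\<Sum>j<c. \<Sum>k<length Gs. \<bar>(Gs ! k) $$ (i, j)\<bar>)"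
    using i by (auto intro!: sum_mono order_trans[OF sum_abs] simp: abs_mult mult_left_le_one_le)
  also have "\<dots> \<le> (\<Sum>i<r. \<Sum>j<c. \<Sum>k<length Gs. \<bar>(Gs ! k) $$ (i, j)\<bar>)"
    using i by (intro member_le_sum[of i "{..<r}" "\<lambda>i. \<Sum>j<c. \<Sum>k<length Gs. \<bar>(Gs ! k) $$ (i, j)\<bar>"]
        sum_nonneg) auto
  finally show "(\<Sum>j<dim_col (block_comb r c Gs \<beta>). \<bar>block_comb r c Gs \<beta> $$ (i, j)\<bar>) \<le> \<dots>"
    by simp
qed

text \<open>The norm of a \<open>1 x T\<close> matrix is its single absolute row sum, and an
  admissible \<beta> makes this norm a member of the set under the supremum.\<close>

lemma l_vec_ge:
  assumes j: "j < q" and H: "H \<in> carrier_mat q n" and Gw: "set Gw \<subseteq> carrier_mat n T"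
    and Mx: "0 \<le> Mx" and \<beta>: "\<beta> \<in> carrier_vec (length AC)" "vec_norm \<beta> \<le> 1"
    and eq: "block_comb (dim_row BC) (dim_col BC) AC \<beta> = BC" and le: "length Gw \<le> length AC"
  shows "Mx * (\<Sum>k<T. \<bar>(H * block_comb n T Gw \<beta>) $$ (j, k)\<bar>) \<le> l_vec Mx H T Gw AC BC $ j"
proof -
  let ?Gs = "map (\<lambda>G. mat_of_row (row H j) * G) Gw"
  let ?S = "{mat_norm (block_comb 1 T ?Gs \<beta>) | \<beta>. \<beta> \<in> carrier_vec (length AC)
    \<and> block_comb (dim_row BC) (dim_col BC) AC \<beta> = BC \<and> vec_norm \<beta> \<le> 1}"
  have row: "mat_of_row (row H j) \<in> carrier_mat 1 n" using H by (auto simp: mat_of_row_def)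
  have "(\<Sum>k<T. \<bar>(H * block_comb n T Gw \<beta>) $$ (j, k)\<bar>)
      = (\<Sum>k<T. \<bar>(mat_of_row (row H j) * block_comb n T Gw \<beta>) $$ (0, k)\<bar>)"
    using j H row by (intro sum.cong) auto
  also have "\<dots> \<le> mat_norm (block_comb 1 T ?Gs \<beta>)"
    using row_sum_le_mat_norm[of 0 "block_comb 1 T ?Gs \<beta>"]
    unfolding block_comb_mult_left[OF row Gw] by simp
  also have "\<dots> \<le> Sup ?S"
  proof (rule cSup_upper)
    show "mat_norm (block_comb 1 T ?Gs \<beta>) \<in> ?S" using \<beta> eq by blast
    \<comment> \<open>A real supremum dominates the members only of a bounded set. The crude
      estimate \<open>mat_norm_block_comb_le\<close> does not depend on the coefficients, so it
      bounds the whole set.\<close>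
    show "bdd_above ?S"
    proof (rule bdd_aboveI)
      fix v assume "v \<in> ?S"
      then show "v \<le> (\<Sum>i<1. \<Sum>j<T. \<Sum>k<length ?Gs. \<bar>(?Gs ! k) $$ (i, j)\<bar>)"
        using le mat_norm_block_comb_le[of _ "length AC" ?Gs 1 T] by fastforce
    qed
  qed
  finally show ?thesis
    using Mx j H by (simp add: l_vec_def mult_left_mono)
qed

text \<open>\<open>y_vec H G\<close> bounds the support function of the centered zonotope in the
  directions of the rows of \<open>H\<close>, by Hoelder's inequality with coefficients of norm at
  most 1.\<close>

lemma zonotope_support_le:
  assumes "w \<in> zonotope G c" "H \<in> carrier_mat q n" "G \<in> carrier_mat n s" "c \<in> carrier_vec n" "j < q"
  shows "row H j \<bullet> w \<le> row H j \<bullet> c + y_vec H G $ j"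
proof -
  obtain z where z: "w = G *\<^sub>v z + c" "z \<in> carrier_vec s" "vec_norm z \<le> 1"
    using assms unfolding zonotope_def by auto
  have "row H j \<bullet> (G *\<^sub>v z) = row (H * G) j \<bullet> z"
    using assoc_mult_mat_vec[of H q n G s z, symmetric] z assms
    by (metis index_mult_mat(2) index_mult_mat_vec carrier_matD(1))
  also have "\<dots> \<le> (\<Sum>k<s. \<bar>(H * G) $$ (j, k)\<bar>) * vec_norm z"
    using abs_scalar_prod_le[of z "row (H * G) j"] z assms by simp
  also have "\<dots> \<le> (\<Sum>k<s. \<bar>(H * G) $$ (j, k)\<bar>)"
    using z vec_norm_nonneg[of z] by (intro mult_right_le_one_le sum_nonneg) auto
  also have "\<dots> = y_vec H G $ j"
    using assms by (auto simp: y_vec_def intro!: sum.cong)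
  finally show ?thesis
    using z assms by (simp add: scalar_prod_add_distrib[of _ n])
qed

lemma zonotope_carrier: "c \<in> carrier_vec n \<Longrightarrow> G \<in> carrier_mat n s \<Longrightarrow> zonotope G c \<subseteq> carrier_vec n"
  by (auto simp: zonotope_def)

section \<open>Robust invariance of the polytope\<close>

theorem theorem2:
  fixes n m p T s\<^sub>w s\<^sub>\<theta> n\<^sub>\<theta> m\<^sub>\<theta> q b :: nat
    and A B :: "real mat"
    and G\<^sub>\<theta> A\<^sub>\<theta> :: "real mat list" and C\<^sub>\<theta> B\<^sub>\<theta> :: "real mat"
    and Gh :: "real mat" and ch :: "real vec"
    and H :: "real mat" and h :: "real vec"
    and xd ud wd :: "nat \<Rightarrow> real vec"
    and U0 X0 X1 D0 Dperp :: "real mat"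
    and Mx :: real
    and Gw AC :: "real mat list" and Cw BC :: "real mat"
    and y l :: "real vec"
    and P VK :: "real mat" and lam \<rho> r :: real
  assumes p: "p = n + m"
    \<comment> \<open>system matrices and prior knowledge\<close>
    and A: "A \<in> carrier_mat n n" and B: "B \<in> carrier_mat n m"
    and C\<theta>: "C\<^sub>\<theta> \<in> carrier_mat n p" and G\<theta>: "block_family n p s\<^sub>\<theta> G\<^sub>\<theta>"
    and A\<theta>: "block_family n\<^sub>\<theta> m\<^sub>\<theta> s\<^sub>\<theta> A\<^sub>\<theta>" and B\<theta>: "B\<^sub>\<theta> \<in> carrier_mat n\<^sub>\<theta> m\<^sub>\<theta>"
    and prior: "append_cols A B \<in> constrained_matrix_zonotope G\<^sub>\<theta> C\<^sub>\<theta> A\<^sub>\<theta> B\<^sub>\<theta>"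
    and stab: "stabilizable A B"
    \<comment> \<open>disturbance zonotope and safe set\<close>
    and Gh: "Gh \<in> carrier_mat n s\<^sub>w" and ch: "ch \<in> carrier_vec n"
    and H: "H \<in> carrier_mat q n" and h: "h \<in> carrier_vec q"
    \<comment> \<open>needed for invariance: \<open>H x \<le> lam h\<close> implies \<open>H x \<le> h\<close> only when \<open>h \<ge> 0\<close>\<close>
    and origin: "0\<^sub>v n \<in> polytope H h"
    \<comment> \<open>data\<close>
    and xd: "\<And>t. t \<le> T \<Longrightarrow> xd t \<in> carrier_vec n"
    and ud: "\<And>t. t < T \<Longrightarrow> ud t \<in> carrier_vec m"
    and wd: "\<And>t. t < T \<Longrightarrow> wd t \<in> zonotope Gh ch"
    and data: "\<And>t. t < T \<Longrightarrow> system_step A B xd ud wd t"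
    and U0: "U0 = mat_of_cols m (map ud [0..<T])"
    and X0: "X0 = mat_of_cols n (map xd [0..<T])"
    and X1: "X1 = mat_of_cols n (map xd [1..<Suc T])"
    and D0: "D0 = X0 @\<^sub>r U0"
    and rank: "full_row_rank D0"
    and Dperp: "kernel_basis_mat D0 Dperp"
    \<comment> \<open>derived quantities\<close>
    and Mx: "\<And>x. x \<in> polytope H h \<Longrightarrow> vec_norm x \<le> Mx"
    and Gw: "Gw = disturbance_gens T Gh" and Cw: "Cw = disturbance_center T ch"
    and b: "b = max T m\<^sub>\<theta>"
    and AC: "AC = constraint_gens n n\<^sub>\<theta> b (block_times Gw Dperp) A\<^sub>\<theta> Gw
                    (map uminus (block_times G\<^sub>\<theta> D0))"
    and BC: "BC = constraint_rhs b ((X1 - Cw) * Dperp) B\<^sub>\<theta> (X1 - C\<^sub>\<theta> * D0) Cw"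
    and y: "y = y_vec H Gh"
    and l: "l = l_vec Mx H T Gw AC BC"
    \<comment> \<open>feasibility; the objective is either \<open>\<rho>\<close> (for a fixed \<open>lam\<close>) or \<open>lam\<close>\<close>
    and lam: "0 < lam" "lam < 1"
    and feasible: "program_constraints H h ch X0 X1 Cw l y lam P VK \<rho>"
    and objective: "r = \<rho> \<or> r = lam"
  shows "robust_invariant A B (U0 * VK) (zonotope Gh ch) (polytope H h)"
proof -
  let ?\<Delta> = "block_comb n T Gw" and ?\<Theta> = "block_comb n p G\<^sub>\<theta>"
  have famGw: "block_family n T (s\<^sub>w * T) Gw"
    using Gh by (auto simp: Gw block_family_def disturbance_gens_eq_map)
  have X0c: "X0 \<in> carrier_mat n T" and U0c: "U0 \<in> carrier_mat m T" and X1c: "X1 \<in> carrier_mat n T"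
    and Cwc: "Cw \<in> carrier_mat n T"
    using ch by (auto simp: X0 U0 X1 Cw disturbance_center_def)
  then have D0c: "D0 \<in> carrier_mat p T" unfolding D0 p by auto
  have ABc: "append_cols A B \<in> carrier_mat n p"
    using A B by (auto simp: append_cols_def p)
  \<comment> \<open>\<^const>\<open>pad_cols\<close> truncates nothing, so the padding is faithful only because \<open>Dperp\<close> has at most
    \<open>T \<le> b\<close> columns.\<close>
  define k where "k = dim_col Dperp"
  have Dpc: "Dperp \<in> carrier_mat T k"
    using kernel_basis_mat_carrier[OF Dperp] unfolding carrier_matD[OF D0c] k_def .
  have kT: "k \<le> T"
    using dim_col_kernel_basis_mat_le[OF Dperp] unfolding carrier_matD[OF D0c] k_def .
  have DD: "D0 * Dperp = 0\<^sub>m p k"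
    using mult_kernel_basis_mat[OF Dperp] unfolding carrier_matD[OF D0c] k_def .
  obtain \<zeta> where \<zeta>: "\<zeta> \<in> carrier_vec s\<^sub>\<theta>" "vec_norm \<zeta> \<le> 1" "append_cols A B = C\<^sub>\<theta> + ?\<Theta> \<zeta>"
    "block_comb n\<^sub>\<theta> m\<^sub>\<theta> A\<^sub>\<theta> \<zeta> = B\<^sub>\<theta>"
    using prior G\<theta> C\<theta> B\<theta> unfolding constrained_matrix_zonotope_def block_family_def by auto
  obtain \<beta> where \<beta>: "\<beta> \<in> carrier_vec (s\<^sub>w * T)" "vec_norm \<beta> \<le> 1"
    "mat_of_cols n (map wd [0..<T]) = Cw + ?\<Delta> \<beta>"
    unfolding Gw Cw using disturbance_sequence_in_matrix_zonotope[OF Gh ch, of T wd] wd by metis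
  \<comment> \<open>\<open>D\<close> is the Delta of the overview, the value of the map
    \<open>?\<Delta>\<close> at \<beta>; \<open>M\<close> collects the parts
    \<open>A x(t) + B u(t)\<close> of the successor states.\<close>
  define D M where "D = ?\<Delta> \<beta>" and "M = A * X0 + B * U0"
  have Dc: "D \<in> carrier_mat n T" and Mc: "M \<in> carrier_mat n T"
    using A X0c B U0c by (auto simp: D_def M_def)
  have "X1 = M + mat_of_cols n (map wd [0..<T])"
  proof (rule eq_matI)
    fix i j assume "i < dim_row (M + mat_of_cols n (map wd [0..<T]))"
      "j < dim_col (M + mat_of_cols n (map wd [0..<T]))"
    then have ij: "i < n" "j < T" by auto
    have "col X0 j = xd j" "col U0 j = ud j"
      using ij xd[of j] ud[of j] unfolding X0 U0 by (auto intro!: col_mat_of_cols)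
    moreover have "wd j \<in> carrier_vec n" using zonotope_carrier[OF ch Gh] wd ij by auto
    ultimately show "X1 $$ (i, j) = (M + mat_of_cols n (map wd [0..<T])) $$ (i, j)"
      using data[OF ij(2)] ij A B X0c U0c xd[of j] ud[of j]
      by (simp add: X1 M_def system_step_def mat_of_cols_index del: upt_Suc)
  qed (use X1c Mc in auto)
  then have X1M: "X1 = M + (Cw + D)" using \<beta>(3) by (simp add: D_def)
  have X1Cw: "X1 - Cw = M + D"
    unfolding X1M using Mc Dc Cwc by (intro eq_matI) auto
  have MD0: "M = append_cols A B * D0"
    unfolding M_def D0 using append_cols_mult_append_rows[OF A B X0c U0c] by simp
  \<comment> \<open>Multiplying by \<open>Dperp\<close> eliminates the unknown \<open>[A B]\<close>,
    so what remains constrains the disturbance alone: the first band.\<close>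
  have "M * Dperp = 0\<^sub>m n k"
    unfolding MD0 using assoc_mult_mat[OF ABc D0c Dpc] DD ABc by simp
  then have Bw: "(X1 - Cw) * Dperp = block_comb n k (block_times Gw Dperp) \<beta>"
    unfolding X1Cw D_def using famGw Dpc Dc[unfolded D_def] Mc
    by (subst block_comb_block_times[OF Dpc]) (auto simp: block_family_def add_mult_distrib_mat)
  let ?Gt = "map uminus (block_times G\<^sub>\<theta> D0)"
  have famGt: "block_family n T s\<^sub>\<theta> ?Gt" and famAw: "block_family n k (s\<^sub>w * T) (block_times Gw Dperp)"
    using G\<theta> D0c famGw Dpc by (auto simp: block_family_def block_times_def)
  have Gt: "block_comb n T ?Gt \<zeta> = - (?\<Theta> \<zeta> * D0)"
    using G\<theta> D0c block_comb_block_times[OF D0c, of G\<^sub>\<theta> n \<zeta>]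
    by (subst block_comb_uminus) (auto simp: block_family_def block_times_def)
  have M\<Theta>: "M = C\<^sub>\<theta> * D0 + ?\<Theta> \<zeta> * D0"
    unfolding MD0 \<zeta>(3) using C\<theta> D0c by (intro add_mult_distrib_mat) auto
  \<comment> \<open>The third band: data and prior must agree on \<open>[A B]\<close>. The minus
    sign inside \<open>?Gt\<close> turns the difference on the right into a sum.\<close>
  have Ct: "(X1 - C\<^sub>\<theta> * D0) - Cw = ?\<Delta> \<beta> - block_comb n T ?Gt \<zeta>"
    unfolding X1M Gt M\<Theta> D_def using C\<theta> D0c Cwc by (intro eq_matI) auto
  have Tb: "T \<le> b" "m\<^sub>\<theta> \<le> b" "k \<le> b" using kT b by auto
  have "block_comb (n + (n\<^sub>\<theta> + n)) b AC (\<beta> @\<^sub>v \<zeta>)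
      = constraint_rhs b ((X1 - Cw) * Dperp) B\<^sub>\<theta> (?\<Delta> \<beta>) (block_comb n T ?Gt \<zeta>)"
    unfolding AC Bw \<zeta>(4)[symmetric]
    by (rule block_comb_constraint_gens[OF famAw A\<theta> famGw famGt Tb(3,2,1) \<beta>(1) \<zeta>(1)])
  also have "\<dots> = BC"
    unfolding BC using X1c C\<theta> D0c Cwc
    by (intro constraint_rhs_cong[where r = n and c = T, OF _ _ _ _ Tb(1) Ct[symmetric]]) auto
  finally have ACBC: "block_comb (dim_row BC) (dim_col BC) AC (\<beta> @\<^sub>v \<zeta>) = BC"
    by (metis dim_row_block_comb dim_col_block_comb)
  have lenAC: "length AC = s\<^sub>w * T + s\<^sub>\<theta>"
    using famAw famGw famGt A\<theta> by (auto simp: AC constraint_gens_def block_family_def)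
  have "vec_norm (\<beta> @\<^sub>v \<zeta>) \<le> 1"
    using \<beta>(1,2) \<zeta>(1,2) unfolding vec_norm_le_iff by auto
  \<comment> \<open>The entries of \<zeta> lie beyond the blocks of \<open>Gw\<close>, where
    \<open>block_comb\<close> ignores them.\<close>
  moreover have "?\<Delta> (\<beta> @\<^sub>v \<zeta>) = ?\<Delta> \<beta>"
    using famGw \<beta>(1) \<zeta>(1) unfolding block_comb_def block_family_def by auto
  \<comment> \<open>The sign of \<open>Mx\<close> comes from a point of the polytope, here the
    origin.\<close>
  moreover have Mx0: "0 \<le> Mx" using Mx[OF origin] vec_norm_nonneg[of "0\<^sub>v n"] by linarith
  ultimately have l_ge: "Mx * (\<Sum>k<T. \<bar>(H * D) $$ (j, k)\<bar>) \<le> l $ j" if "j < q" for j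
    using l_vec_ge[OF that H _ Mx0 _ _ ACBC, of Gw T] famGw \<beta>(1) \<zeta>(1)
    unfolding l D_def lenAC by (auto simp: block_family_def)
  have Pc: "P \<in> carrier_mat q q" and VKc: "VK \<in> carrier_mat T n"
    and Ph: "P *\<^sub>v h \<le> lam \<cdot>\<^sub>v h - H *\<^sub>v ch - \<rho> \<cdot>\<^sub>v l - y"
    and PH: "P * H = H * (M + D) * VK" and VK\<rho>: "mat_norm VK \<le> \<rho>"
    and XV: "X0 * VK = 1\<^sub>m n" and P0: "0\<^sub>m q q \<le> P"
    using feasible H X0c by (auto simp: program_constraints_def X1Cw)
  have h0: "0 \<le> h $ j" if "j < q" for j
    using origin that H h by (auto simp: polytope_def less_eq_vec_def)
  have step: "A *\<^sub>v x + B *\<^sub>v ((U0 * VK) *\<^sub>v x) + w \<in> polytope H h" (is "?x + w \<in> _")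
    if x: "x \<in> polytope H h" and w: "w \<in> zonotope Gh ch" for x w
  proof -
    have xc: "x \<in> carrier_vec n" and Hx: "\<And>j. j < q \<Longrightarrow> (H *\<^sub>v x) $ j \<le> h $ j"
      using x H h by (auto simp: polytope_def less_eq_vec_def)
    have wc: "w \<in> carrier_vec n" using w zonotope_carrier[OF ch Gh] by auto
    \<comment> \<open>\<open>z\<close> expresses the state in data coordinates: \<open>X0\<close>
      maps it to \<open>x\<close> and \<open>U0\<close> maps it to the input, so the closed loop
      acts as \<open>M\<close>.\<close>
    define z where "z = VK *\<^sub>v x"
    have zc: "z \<in> carrier_vec T" using VKc xc by (simp add: z_def)
    have "X0 *\<^sub>v z = x"
      using assoc_mult_mat_vec[OF X0c VKc xc] XV xc by (simp add: z_def)
    moreover have "(U0 * VK) *\<^sub>v x = U0 *\<^sub>v z"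
      using assoc_mult_mat_vec[OF U0c VKc xc] by (simp add: z_def)
    moreover have "M *\<^sub>v z = A *\<^sub>v (X0 *\<^sub>v z) + B *\<^sub>v (U0 *\<^sub>v z)"
      using A B X0c U0c zc unfolding M_def
      by (simp add: add_mult_distrib_mat_vec[of _ n T] assoc_mult_mat_vec)
    ultimately have xz: "?x = M *\<^sub>v z" by simp
    \<comment> \<open>As \<open>X1 - Cw = M + D\<close>, the equality constraint of the program
      rewrites the sum of nominal and disturbance parts as \<open>P H x\<close>.\<close>
    have "H *\<^sub>v (M *\<^sub>v z) + (H * D) *\<^sub>v z = (P * H) *\<^sub>v x"
    proof -
      have "(P * H) *\<^sub>v x = (H * (M + D)) *\<^sub>v z"
        unfolding PH z_def using H Mc Dc VKc xc by (intro assoc_mult_mat_vec) auto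
      also have "\<dots> = H *\<^sub>v (M *\<^sub>v z + D *\<^sub>v z)"
        using assoc_mult_mat_vec[OF H add_carrier_mat[OF Dc, of M] zc]
          add_mult_distrib_mat_vec[OF Mc Dc zc] by simp
      also have "\<dots> = H *\<^sub>v (M *\<^sub>v z) + (H * D) *\<^sub>v z"
        using assoc_mult_mat_vec[OF H Dc zc] Mc Dc zc
          mult_add_distrib_mat_vec[OF H, of "M *\<^sub>v z" "D *\<^sub>v z"] by simp
      finally show ?thesis by simp
    qed
    then have HM: "(H *\<^sub>v (M *\<^sub>v z)) $ j + ((H * D) *\<^sub>v z) $ j = (P *\<^sub>v (H *\<^sub>v x)) $ j" if "j < q" for j
      using that H Dc assoc_mult_mat_vec[OF Pc H xc]
      by (metis carrier_matD(1) dim_mult_mat_vec index_add_vec(1) index_mult_mat(2))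
    have "(H *\<^sub>v (?x + w)) $ j \<le> h $ j" if j: "j < q" for j
    proof -
      have "- ((H * D) *\<^sub>v z) $ j \<le> \<bar>row (H * D) j \<bullet> z\<bar>" using j H by simp
      also have "\<dots> \<le> (\<Sum>k<T. \<bar>(H * D) $$ (j, k)\<bar>) * vec_norm z"
        using abs_scalar_prod_le[of z "row (H * D) j"] j H Dc zc by simp
      also have "\<dots> \<le> (\<Sum>k<T. \<bar>(H * D) $$ (j, k)\<bar>) * (\<rho> * Mx)"
      proof (intro mult_left_mono sum_nonneg)
        have "vec_norm z \<le> mat_norm VK * vec_norm x"
          using vec_norm_mult_le VKc xc by (simp add: z_def)
        also have "\<dots> \<le> \<rho> * Mx"
          using VK\<rho> Mx[OF x] mat_norm_nonneg[of VK] vec_norm_nonneg[of x] by (intro mult_mono) auto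
        finally show "vec_norm z \<le> \<rho> * Mx" .
      qed simp
      also have "\<dots> = \<rho> * (Mx * (\<Sum>k<T. \<bar>(H * D) $$ (j, k)\<bar>))" by simp
      also have "\<dots> \<le> \<rho> * l $ j"
        using l_ge[OF j] VK\<rho> mat_norm_nonneg[of VK] by (intro mult_left_mono) auto
      finally have Dz: "- ((H * D) *\<^sub>v z) $ j \<le> \<rho> * l $ j" .
      \<comment> \<open>Entrywise nonnegativity of \<open>P\<close> preserves the inequality
        \<open>H x \<le> h\<close>.\<close>
      have "(P *\<^sub>v (H *\<^sub>v x)) $ j \<le> (P *\<^sub>v h) $ j"
        using j P0 Pc H h Hx
        by (auto simp: scalar_prod_def less_eq_mat_def intro!: sum_mono mult_left_mono)
      also have "\<dots> \<le> lam * h $ j - (H *\<^sub>v ch) $ j - \<rho> * l $ j - y $ j"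
        using Ph j H h Pc unfolding less_eq_vec_def by (simp add: y y_vec_def l l_vec_def)
      \<comment> \<open>The margin \<open>\<rho> * l $ j\<close> reserved in the program absorbs the
        uncertainty term \<open>Dz\<close>.\<close>
      finally have "(H *\<^sub>v (M *\<^sub>v z)) $ j \<le> lam * h $ j - (H *\<^sub>v ch) $ j - y $ j"
        using HM[OF j] Dz by linarith
      moreover have "(H *\<^sub>v w) $ j \<le> (H *\<^sub>v ch) $ j + y $ j"
        using zonotope_support_le[OF w H Gh ch j] j H by (simp add: y)
      moreover have "(H *\<^sub>v (?x + w)) $ j = (H *\<^sub>v (M *\<^sub>v z)) $ j + (H *\<^sub>v w) $ j"
        unfolding xz using H Mc zc wc j by (simp add: scalar_prod_add_distrib[of _ n])
      moreover have "lam * h $ j \<le> h $ j" using lam h0[OF j] by (simp add: mult_left_le_one_le)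
      ultimately show ?thesis by linarith
    qed
    moreover have "?x + w \<in> carrier_vec n"
      unfolding xz using Mc zc wc by (intro add_carrier_vec mult_mat_vec_carrier)
    ultimately show ?thesis using H h by (auto simp: polytope_def less_eq_vec_def)
  qed
  show ?thesis
    unfolding robust_invariant_def
  proof (intro allI impI)
    fix x w t
    assume x0: "x 0 \<in> polytope H h" and w: "\<forall>t. w t \<in> zonotope Gh ch"
      and sys: "\<forall>t. system_step A B x (\<lambda>s. (U0 * VK) *\<^sub>v x s) w t"
    show "x t \<in> polytope H h"
    proof (induction t)
      case (Suc t)
      have "x (Suc t) = A *\<^sub>v x t + B *\<^sub>v ((U0 * VK) *\<^sub>v x t) + w t"
        using sys by (simp add: system_step_def)
      then show ?case using step[OF Suc] w by simp
    qed (rule x0)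
  qed
qed

end
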